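(* Let $p(z)=\sum_{j=0}^{n}a_jz^j$, with $a_0\neq 0$, be a polynomial of degree $n$ with complex coefficients, and write $\alpha_j=\operatorname{Re}(a_j)$ and $\beta_j=\operatorname{Im}(a_j)$ for $0\le j\le n$. Suppose that for some real numbers $t,s$ and some $\lambda\in\{0,1,2,\ldots,n\}$, $$t+\alpha_{n}\leq \alpha_{n-1}\leq \cdots\leq\alpha_{\lambda}\geq\alpha_{\lambda-1}\geq\alpha_{\lambda-2}\geq\cdots\geq\alpha_{1}\geq\alpha_{0}-s.$$ Then for every $\delta$ with $0<\delta<1$, the number of zeros of $p$ in the disk $|z|\leq\delta$ does not exceed $$\frac{1}{\log (1/\delta)}\log\frac{M_2}{|a_0|},$$ where $$M_2=|\alpha_0|-\alpha_0+|\alpha_n|-\alpha_n+|t|-t+|s|+s+2\alpha_{\lambda}+2\sum_{j=0}^{n}|\beta_j|.$$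
   Context: Zeros are counted with multiplicity. The displayed chain of inequalities means: the sequence $t+\alpha_n,\alpha_{n-1},\ldots,\alpha_{\lambda}$ is nondecreasing and the sequence $\alpha_\lambda,\alpha_{\lambda-1},\ldots,\alpha_1,\alpha_0-s$ is nonincreasing. In the boundary case $\lambda=n$ the left part is read as $t+\alpha_n\le\alpha_n$, and in the boundary case $\lambda=0$ the right part is read as $\alpha_0\ge\alpha_0-s$ (with $\alpha_\lambda=\alpha_0$ being the last term of the left part). *)

theory Defs
  imports Complex_Main "HOL-Computational_Algebra.Polynomial"
begin

definition zeros_in_disk :: "complex poly \<Rightarrow> real \<Rightarrow> nat" where
  "zeros_in_disk p r = size {#z \<in># proots p. cmod z \<le> r#}"

(* The chain
     t + \<alpha> n \<le> \<alpha> (n - 1) \<le> ... \<le> \<alpha> l \<ge> \<alpha> (l - 1) \<ge> ... \<ge> \<alpha> 1 \<ge> \<alpha> 0 - s.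
   Each of the two outermost inequalities has a boundary case: for l = n the left part is
   just t + \<alpha> n \<le> \<alpha> n, and for l = 0 the right part is just \<alpha> 0 - s \<le> \<alpha> 0.  The end values
   \<alpha> n and \<alpha> 0 occur unshifted in a chain only when they are the peak \<alpha> l; for l = n the
   set {l..<n} is empty and for l = 0 the set {1..l} is empty. *)
definition perturbed_unimodal ::
    "(nat \<Rightarrow> real) \<Rightarrow> nat \<Rightarrow> nat \<Rightarrow> real \<Rightarrow> real \<Rightarrow> bool" where
  "perturbed_unimodal \<alpha> n l t s \<longleftrightarrow>
     t + \<alpha> n \<le> (if l = n then \<alpha> n else \<alpha> (n - 1)) \<and>
     antimono_on {l..<n} \<alpha> \<and>
     mono_on {1..l} \<alpha> \<and>
     \<alpha> 0 - s \<le> (if l = 0 then \<alpha> 0 else \<alpha> 1)"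

end

theory Submission
  imports Defs "HOL-Complex_Analysis.Conformal_Mappings"
    "HOL-Computational_Algebra.Fundamental_Theorem_Algebra"
begin

text \<open>
  Multiplication by \<open>1 - z\<close> loses no zeros and turns the coefficients of \<open>p\<close> into
  their consecutive differences.  On the unit circle \<open>(1 - z) p(z)\<close> is therefore bounded by the
  total variation of the coefficients plus the moduli of the two end coefficients.  The
  hypothesis makes the real parts unimodal up to the two perturbations \<open>t\<close> and \<open>s\<close>, so that
  their variation telescopes; the imaginary parts are estimated term by term, each being met
  twice.  The resulting bound is \<open>M2\<close> (lemma \<open>norm_times_one_minus_le_variation\<close> together
  with \<open>sum_abs_diff_rise_le\<close> and \<open>sum_abs_diff_fall_le\<close>).

  The number \<open>N\<close> of zeros in the disk then follows from a form of Jensen's inequality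
  (lemma \<open>norm_poly_0_le_power_zeros_in_disk\<close>): a polynomial bounded by \<open>M\<close> on the unit circle
  has modulus at most \<open>M * \<delta> ^ N\<close> at the origin.  Applied to \<open>(1 - z) p(z)\<close>, whose value at
  the origin is \<open>coeff p 0\<close>, this gives the theorem after taking logarithms.
\<close>

section \<open>Jensen's inequality for polynomials\<close>

lemma norm_reflected_factor:
  fixes a z :: complex
  assumes "cmod z = 1"
  shows "cmod (1 - cnj a * z) = cmod (z - a)"
proof -
  have "z * cnj z = 1"
    using assms by (simp add: complex_norm_square[symmetric])
  then have "1 - cnj a * z = z * cnj (z - a)"
    by (simp add: algebra_simps)
  then show ?thesis
    using assms by (metis complex_mod_cnj mult_1 norm_mult)
qed

text \<open>
  Replacing each factor \<open>z - a\<close> by its reflection \<open>1 - cnj a * z\<close> does not change the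
  modulus on the unit circle, but at the origin it changes the modulus of the factor from
  \<open>cmod a \<le> r\<close> to \<open>1\<close>.  The gain \<open>r\<close> for every element of \<open>A\<close> is then read off from the
  maximum modulus principle for the reflected product.
\<close>

lemma norm_poly_0_le_power_size_roots:
  fixes q :: "complex poly" and A :: "complex multiset"
  assumes A: "\<And>a. a \<in># A \<Longrightarrow> cmod a \<le> r"
    and M: "\<And>z. cmod z = 1 \<Longrightarrow> cmod (poly ((\<Prod>a\<in>#A. [:-a, 1:]) * q) z) \<le> M"
  shows "cmod (poly ((\<Prod>a\<in>#A. [:-a, 1:]) * q) 0) \<le> M * r ^ size A"
proof -
  define R where "R = (\<Prod>a\<in>#A. [:1, - cnj a:]) * q"
  have circle: "cmod (poly (\<Prod>a\<in>#B. [:1, - cnj a:]) z) = cmod (poly (\<Prod>a\<in>#B. [:-a, 1:]) z)"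
    if "cmod z = 1" for z and B :: "complex multiset"
  proof (induction B)
    case (add x B)
    have "cmod (1 - z * cnj x) = cmod (z - x)"
      using norm_reflected_factor[OF that, of x] by (simp add: mult.commute)
    with add show ?case
      by (simp add: norm_mult del: mult_pCons_left)
  qed simp
  have R0: "poly R 0 = poly q 0"
    unfolding R_def poly_mult by (induction A) auto
  have "cmod (poly R 0) \<le> M"
  proof (rule maximum_modulus_frontier[of "poly R" "cball 0 1"])
    show "cmod (poly R z) \<le> M" if "z \<in> frontier (cball 0 1)" for z
    proof -
      from that have z: "cmod z = 1"
        by simp
      show ?thesis
        using M[OF z] circle[OF z, of A] by (simp add: R_def norm_mult)
    qed
  qed (auto intro!: holomorphic_intros continuous_intros)
  with R0 have q0: "cmod (poly q 0) \<le> M"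
    by simp
  have roots: "cmod (poly (\<Prod>a\<in>#A. [:-a, 1:]) 0) \<le> r ^ size A"
    using A
  proof (induction A)
    case (add x A)
    then have "cmod x \<le> r"
      by simp
    moreover from this have "0 \<le> r"
      using norm_ge_zero order_trans by blast
    ultimately show ?case
      using add by (simp add: norm_mult mult_mono)
  qed simp
  have "cmod (poly q 0) * cmod (poly (\<Prod>a\<in>#A. [:-a, 1:]) 0) \<le> M * r ^ size A"
    using q0 roots by (intro mult_mono) (auto intro: order_trans[OF norm_ge_zero])
  then show ?thesis
    by (simp add: norm_mult mult.commute)
qed

text \<open>
  Over \<open>\<complex>\<close> a polynomial splits into linear factors, so the zeros in the disk, repeated according to
  multiplicity, may serve as the multiset \<open>A\<close> above, and the zeros outside go into the cofactor.
\<close>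

lemma norm_poly_0_le_power_zeros_in_disk:
  assumes M: "\<And>z. cmod z = 1 \<Longrightarrow> cmod (poly p z) \<le> M"
  shows "cmod (poly p 0) \<le> M * r ^ zeros_in_disk p r"
proof -
  define A B where "A = {#z \<in># proots p. cmod z \<le> r#}" and "B = {#z \<in># proots p. \<not> cmod z \<le> r#}"
  define q where "q = smult (lead_coeff p) (\<Prod>a\<in>#B. [:-a, 1:])"
  have "proots p = A + B"
    unfolding A_def B_def by (rule multiset_partition)
  then have p: "p = (\<Prod>a\<in>#A. [:-a, 1:]) * q"
    using complex_poly_decompose_multiset[of p] by (simp add: q_def)
  have "cmod (poly ((\<Prod>a\<in>#A. [:-a, 1:]) * q) 0) \<le> M * r ^ size A"
  proof (rule norm_poly_0_le_power_size_roots)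
    show "cmod a \<le> r" if "a \<in># A" for a
      using that by (simp add: A_def)
    show "cmod (poly ((\<Prod>a\<in>#A. [:-a, 1:]) * q) z) \<le> M" if "cmod z = 1" for z
      using M[OF that] by (simp only: p[symmetric])
  qed
  then have "cmod (poly p 0) \<le> M * r ^ size A"
    by (simp only: p[symmetric])
  then show ?thesis
    by (simp only: zeros_in_disk_def A_def)
qed

lemma zeros_in_disk_le_mult:
  assumes "q * p \<noteq> 0"
  shows "zeros_in_disk p r \<le> zeros_in_disk (q * p) r"
  using assms by (simp add: zeros_in_disk_def proots_mult)

section \<open>The variation of the coefficients bounds the polynomial\<close>

lemma times_one_minus_power_sum:
  fixes z :: "'a :: comm_ring_1"
  shows "(1 - z) * (\<Sum>j\<le>n. a j * z ^ j)
    = a 0 + (\<Sum>j=1..n. (a j - a (j - 1)) * z ^ j) - a n * z ^ Suc n"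
  by (induction n) (simp_all add: algebra_simps)

lemma norm_times_one_minus_le_variation:
  fixes z :: complex
  assumes z: "cmod z = 1"
  shows "cmod ((1 - z) * (\<Sum>j\<le>n. a j * z ^ j))
    \<le> cmod (a 0) + (\<Sum>j=1..n. cmod (a j - a (j - 1))) + cmod (a n)"
proof -
  have "cmod (\<Sum>j=1..n. (a j - a (j - 1)) * z ^ j) \<le> (\<Sum>j=1..n. cmod (a j - a (j - 1)))"
    using z by (intro sum_norm_le) (simp add: norm_mult norm_power)
  moreover have "cmod (a n * z ^ Suc n) = cmod (a n)"
    using z by (simp add: norm_mult norm_power)
  ultimately show ?thesis
    unfolding times_one_minus_power_sum
    by (smt (verit) norm_triangle_ineq norm_triangle_ineq4)
qed

text \<open>
  No monotonicity is available for the imaginary parts, so their differences are split by the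
  triangle inequality.  With the two end terms read as differences from \<open>0\<close>, each \<open>\<bar>Im (a j)\<bar>\<close>
  then occurs exactly twice, in the two differences that meet at \<open>j\<close>.
\<close>

lemma variation_le_Re_Im:
  fixes a :: "nat \<Rightarrow> complex"
  shows "cmod (a 0) + (\<Sum>j=1..n. cmod (a j - a (j - 1))) + cmod (a n)
    \<le> \<bar>Re (a 0)\<bar> + (\<Sum>j=1..n. \<bar>Re (a j) - Re (a (j - 1))\<bar>) + \<bar>Re (a n)\<bar>
        + 2 * (\<Sum>j=0..n. \<bar>Im (a j)\<bar>)"
proof -
  \<comment> \<open>Until the end term \<open>cmod (a n)\<close> is added, the last imaginary part has occurred only once;
    the subtracted term is what pays for the next difference in the induction.\<close>
  have step: "cmod (a 0) + (\<Sum>j=1..n. cmod (a j - a (j - 1)))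
    \<le> \<bar>Re (a 0)\<bar> + (\<Sum>j=1..n. \<bar>Re (a j) - Re (a (j - 1))\<bar>)
        + 2 * (\<Sum>j=0..n. \<bar>Im (a j)\<bar>) - \<bar>Im (a n)\<bar>"
  proof (induction n)
    case 0
    show ?case
      using cmod_le[of "a 0"] by simp
  next
    case (Suc n)
    have "cmod (a (Suc n) - a n) \<le> \<bar>Re (a (Suc n)) - Re (a n)\<bar> + \<bar>Im (a (Suc n))\<bar> + \<bar>Im (a n)\<bar>"
      using cmod_le[of "a (Suc n) - a n"] by simp
    with Suc show ?case
      by simp
  qed
  show ?thesis
    using step cmod_le[of "a n"] by simp
qed

section \<open>The variation of a perturbed unimodal sequence\<close>

text \<open>
  The perturbation \<open>s\<close> enters through the first difference alone,
  \<open>\<bar>\<alpha> 1 - \<alpha> 0\<bar> \<le> (\<alpha> 1 - \<alpha> 0 + s) + \<bar>s\<bar>\<close>; all later differences are nonnegative and telescope.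
\<close>

lemma sum_abs_diff_rise_le:
  fixes \<alpha> :: "nat \<Rightarrow> real"
  assumes "mono_on {1..l} \<alpha>" and "\<alpha> 0 - s \<le> (if l = 0 then \<alpha> 0 else \<alpha> 1)"
  shows "(\<Sum>j=1..l. \<bar>\<alpha> j - \<alpha> (j - 1)\<bar>) \<le> \<alpha> l - \<alpha> 0 + \<bar>s\<bar> + s"
  using assms
proof (induction l)
  case (Suc l)
  show ?case
  proof (cases "l = 0")
    case True
    then show ?thesis
      using Suc.prems by simp
  next
    case False
    have "mono_on {1..l} \<alpha>"
      using Suc.prems(1) by (rule mono_on_subset) auto
    moreover have "\<alpha> l \<le> \<alpha> (Suc l)"
      using Suc.prems(1) False by (intro mono_onD[of "{1..Suc l}" \<alpha>]) auto
    ultimately show ?thesis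
      using Suc False by simp
  qed
qed simp

text \<open>
  Here the perturbation sits in the last difference,
  \<open>\<bar>\<alpha> n - \<alpha> (n - 1)\<bar> \<le> (\<alpha> (n - 1) - \<alpha> n - t) + \<bar>t\<bar>\<close>.  For \<open>l = n\<close> the sum is empty and
  \<open>\<bar>t\<bar> - t \<ge> 0\<close> suffices.
\<close>

lemma sum_abs_diff_fall_le:
  fixes \<alpha> :: "nat \<Rightarrow> real"
  assumes "l \<le> n" and "antimono_on {l..<n} \<alpha>"
    and "t + \<alpha> n \<le> (if l = n then \<alpha> n else \<alpha> (n - 1))"
  shows "(\<Sum>j=Suc l..n. \<bar>\<alpha> j - \<alpha> (j - 1)\<bar>) \<le> \<alpha> l - \<alpha> n + \<bar>t\<bar> - t"
proof (cases "l = n")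
  case False
  with assms(1) obtain m where m: "n = Suc m" "l \<le> m"
    by (cases n) auto
  have fall: "(\<Sum>j=Suc l..k. \<bar>\<alpha> j - \<alpha> (j - 1)\<bar>) = \<alpha> l - \<alpha> k" if "l \<le> k" "k \<le> m" for k
    using that
  proof (induction k rule: dec_induct)
    case (step k)
    have "\<alpha> (Suc k) \<le> \<alpha> k"
      using step m by (intro monotone_onD[OF assms(2)]) auto
    with step show ?case
      by simp
  qed simp
  show ?thesis
    using fall[of m] m assms(3) by simp
qed simp

lemma sum_abs_diff_perturbed_unimodal_le:
  assumes "l \<le> n" and "perturbed_unimodal \<alpha> n l t s"
  shows "(\<Sum>j=1..n. \<bar>\<alpha> j - \<alpha> (j - 1)\<bar>) \<le> 2 * \<alpha> l - \<alpha> 0 - \<alpha> n + \<bar>t\<bar> - t + \<bar>s\<bar> + s"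
proof -
  have "(\<Sum>j=1..n. \<bar>\<alpha> j - \<alpha> (j - 1)\<bar>)
      = (\<Sum>j=1..l. \<bar>\<alpha> j - \<alpha> (j - 1)\<bar>) + (\<Sum>j=Suc l..n. \<bar>\<alpha> j - \<alpha> (j - 1)\<bar>)"
    using assms(1) sum.ub_add_nat[of 1 l _ "n - l"] by simp
  then show ?thesis
    using assms sum_abs_diff_rise_le[of l \<alpha> s] sum_abs_diff_fall_le[of l n \<alpha> t]
    by (simp add: perturbed_unimodal_def)
qed

section \<open>The number of zeros in the disk\<close>

theorem theorem2:
  fixes p :: "complex poly" and n l :: nat and t s \<delta> :: real
    and \<alpha> \<beta> :: "nat \<Rightarrow> real" and M2 :: real
  defines "\<alpha> \<equiv> (\<lambda>j. Re (coeff p j))"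
    and "\<beta> \<equiv> (\<lambda>j. Im (coeff p j))"
    and "M2 \<equiv> \<bar>\<alpha> 0\<bar> - \<alpha> 0 + \<bar>\<alpha> n\<bar> - \<alpha> n + \<bar>t\<bar> - t + \<bar>s\<bar> + s
               + 2 * \<alpha> l + 2 * (\<Sum>j=0..n. \<bar>\<beta> j\<bar>)"
  assumes "degree p = n"
    and "coeff p 0 \<noteq> 0"
    and "l \<le> n"
    and "perturbed_unimodal \<alpha> n l t s"
    and "0 < \<delta>" and "\<delta> < 1"
  shows "real (zeros_in_disk p \<delta>) \<le> 1 / ln (1 / \<delta>) * ln (M2 / cmod (coeff p 0))"
proof -
  define F where "F = [:1, -1:] * p"
  define N where "N = zeros_in_disk p \<delta>"
  have circle: "cmod (poly F z) \<le> M2" if "cmod z = 1" for z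
  proof -
    have "poly F z = (1 - z) * (\<Sum>j\<le>n. coeff p j * z ^ j)"
      using \<open>degree p = n\<close> by (simp add: F_def poly_altdef[of p] left_diff_distrib)
    then have "cmod (poly F z)
        \<le> \<bar>\<alpha> 0\<bar> + (\<Sum>j=1..n. \<bar>\<alpha> j - \<alpha> (j - 1)\<bar>) + \<bar>\<alpha> n\<bar> + 2 * (\<Sum>j=0..n. \<bar>\<beta> j\<bar>)"
      using norm_times_one_minus_le_variation[OF that, of "coeff p" n]
        variation_le_Re_Im[of "coeff p" n]
      by (simp add: \<alpha>_def \<beta>_def)
    then show ?thesis
      using sum_abs_diff_perturbed_unimodal_le[OF \<open>l \<le> n\<close> \<open>perturbed_unimodal \<alpha> n l t s\<close>]
      by (simp add: M2_def)
  qed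
  have "poly F 0 \<noteq> 0"
    using \<open>coeff p 0 \<noteq> 0\<close> by (simp add: F_def poly_0_coeff_0)
  then have "F \<noteq> 0"
    by auto
  then have N_le: "N \<le> zeros_in_disk F \<delta>"
    unfolding N_def F_def by (rule zeros_in_disk_le_mult)
  have "0 \<le> M2"
    using order_trans[OF norm_ge_zero circle[of 1]] by simp
  have "cmod (coeff p 0) = cmod (poly F 0)"
    by (simp add: F_def poly_0_coeff_0)
  also have "\<dots> \<le> M2 * \<delta> ^ zeros_in_disk F \<delta>"
    using circle by (rule norm_poly_0_le_power_zeros_in_disk)
  also have "\<dots> \<le> M2 * \<delta> ^ N"
    using N_le \<open>0 \<le> M2\<close> \<open>0 < \<delta>\<close> \<open>\<delta> < 1\<close> by (intro mult_left_mono power_decreasing) auto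
  finally have "(1 / \<delta>) ^ N \<le> M2 / cmod (coeff p 0)"
    using \<open>coeff p 0 \<noteq> 0\<close> \<open>0 < \<delta>\<close>
    by (simp add: power_one_over pos_le_divide_eq pos_divide_le_eq)
  then have "ln ((1 / \<delta>) ^ N) \<le> ln (M2 / cmod (coeff p 0))"
    using \<open>0 < \<delta>\<close> by (intro ln_mono) auto
  then have "real N * ln (1 / \<delta>) \<le> ln (M2 / cmod (coeff p 0))"
    using \<open>0 < \<delta>\<close> by (simp add: ln_realpow)
  moreover have "0 < ln (1 / \<delta>)"
    using \<open>0 < \<delta>\<close> \<open>\<delta> < 1\<close> by simp
  ultimately have "real N \<le> ln (M2 / cmod (coeff p 0)) / ln (1 / \<delta>)"
    by (simp only: pos_le_divide_eq)
  then show ?thesis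
    by (simp only: N_def times_divide_eq_left mult_1)
qed

end
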